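(* For all time series $S$ and $T$ over $\mathbb R^k$ with $\min\{\#S,\#T\}\ge 2$, $d^\delta_1(S,T)\le\lfloor 2\cdot\log_2(\min\{\#S,\#T\}-1)\rfloor\cdot d^C_1(S,T)$.
   Context: A time series over $\mathbb R^k$ is a finite sequence $T=(t_0,\dots,t_{n-1})$ of vectors in $\mathbb R^k$, with length $\#T=n$; $T_b^\ell=(t_b,\dots,t_{b+\ell-1})$. For equal-length $S,T$, $d_1(S,T)=\sum_i\|s_i-t_i\|_2$; if $\#S=m\le n=\#T$, $d_1(S,T)=d_1(T,S)=\min_{b\in[0,n-m]}d_1(S,T_b^m)$. $d_1^C(S,T)=\inf_{M,v}d_1(S,M\cdot T+v)$ over real orthogonal $k\times k$ matrices $M$ and $v\in\mathbb R^k$, where $M\cdot T+v=(Mt_i+v)_i$. The reduced structure of $T$ is $\delta T=(\|t_i-t_{i+j}\|_2)_{i\in[0,n-1),\,j\in[1,n-i),\,j\text{ a power of }2}$. For equal-length $S,T$, $d^\delta_1(S,T)=\sum_{i,j}|(\delta S)_{i,j}-(\delta T)_{i,j}|$; for $\#S=m\le n=\#T$, $d^\delta_1(S,T)=d^\delta_1(T,S)=\min_{b\in[0,n-m]}d^\delta_1(S,T_b^m)$.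
   Formalization: The hypothesis min{#S,#T} ≥ 2 is replaced by min{#S,#T} ≥ 3, since for length 2 the factor ⌊2·log₂ 1⌋ is 0 and the claim fails, e.g. for S=(0,0), T=(0,e) with ‖e‖=1, where d^δ_1(S,T)=1. *)

theory Defs
  imports "HOL-Analysis.Analysis"
begin

type_synonym 'k time_series = "(real ^ 'k) list"

definition subseries :: "'k time_series \<Rightarrow> nat \<Rightarrow> nat \<Rightarrow> 'k time_series" where
  "subseries T b l = take l (drop b T)"

text \<open>
  Both distances below are given first for series of equal length and then extended by sliding
  the shorter series along the longer one.
\<close>

definition sliding_min ::
  "('k time_series \<Rightarrow> 'k time_series \<Rightarrow> real) \<Rightarrow> 'k time_series \<Rightarrow> 'k time_series \<Rightarrow> real" where
  "sliding_min d S T =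
    (if length S \<le> length T
     then Min ((\<lambda>b. d S (subseries T b (length S))) ` {0..length T - length S})
     else Min ((\<lambda>b. d T (subseries S b (length T))) ` {0..length S - length T}))"

definition dist1_eq :: "('k::finite) time_series \<Rightarrow> 'k time_series \<Rightarrow> real" where
  "dist1_eq S T = (\<Sum>i<length S. norm (S ! i - T ! i))"

definition dist1 :: "('k::finite) time_series \<Rightarrow> 'k time_series \<Rightarrow> real" where
  "dist1 = sliding_min dist1_eq"

definition transform :: "real ^ 'k ^ 'k \<Rightarrow> real ^ 'k \<Rightarrow> ('k::finite) time_series \<Rightarrow> 'k time_series" where
  "transform M v T = map (\<lambda>t. M *v t + v) T"

definition congruence_dist1 :: "('k::finite) time_series \<Rightarrow> 'k time_series \<Rightarrow> real" where
  "congruence_dist1 S T =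
    (INF (M, v) \<in> {M. orthogonal_matrix M} \<times> UNIV. dist1 S (transform M v T))"

definition reduced_index :: "nat \<Rightarrow> (nat \<times> nat) set" where
  "reduced_index n = {(i, j). i < n - 1 \<and> 1 \<le> j \<and> j < n - i \<and> (\<exists>p. j = 2 ^ p)}"

definition reduced_structure :: "('k::finite) time_series \<Rightarrow> nat \<times> nat \<Rightarrow> real" where
  "reduced_structure T =
    restrict (\<lambda>(i, j). norm (T ! i - T ! (i + j))) (reduced_index (length T))"

definition delta_dist1_eq :: "('k::finite) time_series \<Rightarrow> 'k time_series \<Rightarrow> real" where
  "delta_dist1_eq S T =
    (\<Sum>ij \<in> reduced_index (length S). \<bar>reduced_structure S ij - reduced_structure T ij\<bar>)"

definition delta_dist1 :: "('k::finite) time_series \<Rightarrow> 'k time_series \<Rightarrow> real" where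
  "delta_dist1 = sliding_min delta_dist1_eq"

lemma finite_reduced_index: "finite (reduced_index n)"
  by (rule finite_subset[of _ "{..n} \<times> {..n}"]) (auto simp: reduced_index_def)

text \<open>
  For series of length 2 the factor \<open>\<lfloor>2 * log 2 (2 - 1)\<rfloor>\<close> is \<open>0\<close>, while the reduced structure still
  has the entry at \<open>(0, 1)\<close>, since \<open>1 = 2 ^ 0\<close>.  Hence, in every dimension, the estimate by
  \<open>\<lfloor>2 * log 2 (min (length S) (length T) - 1)\<rfloor> * congruence_dist1 S T\<close> fails at minimal length 2
  and can only be claimed from minimal length 3 on.
\<close>

lemma delta_dist1_bound_fails_at_length_2:
  "\<exists>S T :: ('k::finite) time_series. min (length S) (length T) = 2 \<and>
     \<not> delta_dist1 S T
       \<le> real_of_int \<lfloor>2 * log 2 (real (min (length S) (length T)) - 1)\<rfloor> * congruence_dist1 S T"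
proof -
  let ?S = "[0, 0] :: 'k time_series" and ?T = "[0, axis undefined 1] :: 'k time_series"
  have idx: "reduced_index (Suc (Suc 0)) = {(0, 1)}"
  proof -
    have "i = 0 \<and> j = 1" if "(i, j) \<in> reduced_index (Suc (Suc 0))" for i j
      using that unfolding reduced_index_def mem_Collect_eq case_prod_conv by linarith
    moreover have "(0, 1) \<in> reduced_index (Suc (Suc 0))"
      by (auto simp: reduced_index_def intro: exI[of _ 0])
    ultimately show ?thesis by (auto simp del: One_nat_def)
  qed
  have "delta_dist1 ?S ?T = 1"
    by (simp add: delta_dist1_def sliding_min_def subseries_def delta_dist1_eq_def
        reduced_structure_def idx)
  then show ?thesis
    by (intro exI[of _ ?S] exI[of _ ?T]) simp
qed

end

theory Submission
  imports Defs
begin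

text \<open>
  The reduced structure is invariant under congruences, so it suffices to compare it with
  \<open>dist1_eq\<close> for series of equal length \<open>n\<close>.  By the triangle inequality, the entry at \<open>(i, j)\<close>
  contributes at most the errors at the positions \<open>i\<close> and \<open>i + j\<close>.  The error at position \<open>l\<close> is
  thus counted once for every power of two up to \<open>l\<close> and once for every power of two up to
  \<open>n - 1 - l\<close>.  There are at most \<open>log 2 (2 * x)\<close> powers of two up to \<open>x \<ge> 1\<close>, and
  \<open>2 * a * (2 * b) \<le> (a + b)\<^sup>2\<close> bounds the total number by \<open>2 * log 2 (n - 1)\<close>.
\<close>

definition powers_upto :: "nat \<Rightarrow> nat set" where
  "powers_upto x = {j. j \<le> x \<and> (\<exists>p. j = 2 ^ p)}"

lemma finite_powers_upto [simp]: "finite (powers_upto x)"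
  by (rule finite_subset[of _ "{..x}"]) (auto simp: powers_upto_def)

lemma powers_upto_0 [simp]: "powers_upto 0 = {}"
  by (auto simp: powers_upto_def)

text \<open>If \<open>2 ^ k\<close> is the largest power of two up to \<open>x\<close>, there are at
  most \<open>k + 1\<close> candidates, and \<open>2 ^ (k + 1) <= 2 * x\<close>. The exponential
  form lets two such bounds be multiplied.\<close>

lemma two_power_card_powers_upto_le:
  assumes "x \<ge> 1"
  shows "2 ^ card (powers_upto x) \<le> 2 * x"
proof -
  obtain k where k: "2 ^ k \<le> x" "x < 2 ^ (k + 1)"
    using ex_power_ivl1[of 2 x] assms by auto
  have "powers_upto x \<subseteq> (\<lambda>p. 2 ^ p) ` {..k}"
  proof
    fix j assume "j \<in> powers_upto x"
    then obtain p where p: "j = 2 ^ p" "j \<le> x" by (auto simp: powers_upto_def)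
    then have "(2::nat) ^ p < 2 ^ (k + 1)" using k by linarith
    then have "p < k + 1" by (rule power_less_imp_less_exp[rotated]) simp
    then show "j \<in> (\<lambda>p. 2 ^ p) ` {..k}" using p by auto
  qed
  then have "card (powers_upto x) \<le> card {..k}"
    by (meson card_image_le card_mono finite_atMost finite_imageI order_trans)
  then have "(2::nat) ^ card (powers_upto x) \<le> 2 ^ (k + 1)"
    by (intro power_increasing) auto
  then show ?thesis using k by simp
qed

text \<open>The floor costs nothing because the left side is an integer. For
  \<open>a + b = 1\<close> the claim would read \<open>1 <= 0\<close>; this is where length at least
  3 enters.\<close>

lemma card_powers_upto_add_le:
  assumes "a + b \<ge> 2"
  shows "int (card (powers_upto a) + card (powers_upto b)) \<le> \<lfloor>2 * log 2 (real (a + b))\<rfloor>"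
proof -
  let ?c = "\<lambda>x. card (powers_upto x)"
  \<comment> \<open>Covers \<open>a = 0\<close> or \<open>b = 0\<close>, where the product bound
    breaks down: the empty count gives \<open>2 ^ 0 = 1\<close>, which exceeds
    \<open>2 * 0\<close>.\<close>
  have end_case: "2 ^ ?c x \<le> x\<^sup>2" if "x \<ge> 2" for x
  proof -
    have "2 ^ ?c x \<le> 2 * x" using two_power_card_powers_upto_le that by simp
    also have "\<dots> \<le> x\<^sup>2" using that by (simp add: power2_eq_square)
    finally show ?thesis .
  qed
  have "2 ^ (?c a + ?c b) \<le> (a + b)\<^sup>2"
  proof (cases "a = 0 \<or> b = 0")
    case True
    then show ?thesis using end_case[of "a + b"] assms by auto
  next
    case False
    then have "2 ^ (?c a + ?c b) \<le> (2 * a) * (2 * b)"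
      unfolding power_add by (intro mult_le_mono two_power_card_powers_upto_le) auto
    also have "\<dots> \<le> (a + b)\<^sup>2"
    proof -
      have "0 \<le> (int a - int b)\<^sup>2" by simp
      then have "int ((2 * a) * (2 * b)) \<le> int ((a + b)\<^sup>2)"
        by (simp add: power2_eq_square algebra_simps)
      then show ?thesis by linarith
    qed
    finally show ?thesis .
  qed
  then have "real (2 ^ (?c a + ?c b)) \<le> real ((a + b)\<^sup>2)" by (rule of_nat_mono)
  then have "2 powr real (?c a + ?c b) \<le> real (a + b) ^ 2"
    by (simp only: powr_realpow of_nat_power of_nat_numeral zero_less_numeral)
  then have "real (?c a + ?c b) \<le> log 2 (real (a + b) ^ 2)"
    using assms by (subst le_log_iff) auto
  also have "\<dots> = 2 * log 2 (real (a + b))"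
    using assms by (subst log_nat_power) auto
  finally show ?thesis by (simp add: le_floor_iff)
qed

text \<open>The row \<open>i = n - 1\<close> can be added since \<open>powers_upto 0\<close> is
  empty, so that \<open>i\<close> runs over all positions.\<close>

lemma reduced_index_eq_Sigma:
  "reduced_index n = (SIGMA i:{..<n}. powers_upto (n - 1 - i))"
proof -
  have "(i < n - 1 \<and> 1 \<le> j \<and> j < n - i \<and> (\<exists>p. j = 2 ^ p)) \<longleftrightarrow>
      (i < n \<and> j \<le> n - 1 - i \<and> (\<exists>p. j = 2 ^ p))" for i j :: nat
  proof (cases "\<exists>p. j = 2 ^ p")
    case True
    then have "1 \<le> j" by auto
    then have "i < n - 1 \<and> 1 \<le> j \<and> j < n - i \<longleftrightarrow> i < n \<and> j \<le> n - 1 - i" by linarith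
    with True show ?thesis by blast
  qed simp
  then show ?thesis
    unfolding reduced_index_def powers_upto_def by (auto simp del: One_nat_def)
qed

lemma sum_reduced_index_fst:
  fixes e :: "nat \<Rightarrow> real"
  shows "(\<Sum>(i, j)\<in>reduced_index n. e i) = (\<Sum>l<n. card (powers_upto (n - 1 - l)) * e l)"
  unfolding reduced_index_eq_Sigma by (subst sum.Sigma[symmetric]) auto

text \<open>Regroup the pairs by their right endpoint \<open>l = i + j\<close>; the left endpoint
  \<open>l - j\<close> exists exactly when \<open>j <= l\<close>.\<close>

lemma sum_reduced_index_snd:
  fixes e :: "nat \<Rightarrow> real"
  shows "(\<Sum>(i, j)\<in>reduced_index n. e (i + j)) = (\<Sum>l<n. card (powers_upto l) * e l)"
proof -
  have "(\<Sum>(i, j)\<in>reduced_index n. e (i + j)) =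
      (\<Sum>(l, j)\<in>(SIGMA l:{..<n}. powers_upto l). e l)"
    unfolding reduced_index_eq_Sigma
    by (rule sum.reindex_bij_witness[of _ "\<lambda>(l, j). (l - j, j)" "\<lambda>(i, j). (i + j, j)"])
      (auto simp: powers_upto_def)
  also have "\<dots> = (\<Sum>l<n. card (powers_upto l) * e l)"
    by (subst sum.Sigma[symmetric]) auto
  finally show ?thesis .
qed

lemma delta_dist1_eq_le_dist1_eq:
  fixes S T :: "('k::finite) time_series"
  assumes len: "length S = n" "length T = n" and n: "n \<ge> 3"
  shows "delta_dist1_eq S T \<le> real_of_int \<lfloor>2 * log 2 (real n - 1)\<rfloor> * dist1_eq S T"
proof -
  define e where "e l = norm (S ! l - T ! l)" for l
  have "delta_dist1_eq S T =
      (\<Sum>(i, j)\<in>reduced_index n. \<bar>norm (S ! i - S ! (i + j)) - norm (T ! i - T ! (i + j))\<bar>)"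
    unfolding delta_dist1_eq_def reduced_structure_def len
    by (intro sum.cong) auto
  also have "\<dots> \<le> (\<Sum>(i, j)\<in>reduced_index n. e i + e (i + j))"
  proof (intro sum_mono, clarify)
    fix i j
    show "\<bar>norm (S ! i - S ! (i + j)) - norm (T ! i - T ! (i + j))\<bar> \<le> e i + e (i + j)"
      unfolding e_def by norm
  qed
  also have "\<dots> = (\<Sum>(i, j)\<in>reduced_index n. e i) + (\<Sum>(i, j)\<in>reduced_index n. e (i + j))"
    by (simp add: sum.distrib case_prod_unfold)
  also have "\<dots> =
      (\<Sum>l<n. real (card (powers_upto l) + card (powers_upto (n - 1 - l))) * e l)"
    unfolding sum_reduced_index_fst sum_reduced_index_snd
    by (simp add: sum.distrib algebra_simps)
  also have "\<dots> \<le> (\<Sum>l<n. real_of_int \<lfloor>2 * log 2 (real n - 1)\<rfloor> * e l)"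
  proof (intro sum_mono mult_right_mono)
    fix l assume "l \<in> {..<n}"
    \<comment> \<open>The two arguments have the same sum at every position, so a single constant
      bounds all coefficients.\<close>
    then have "l + (n - 1 - l) = n - 1" by auto
    then have "int (card (powers_upto l) + card (powers_upto (n - 1 - l)))
        \<le> \<lfloor>2 * log 2 (real n - 1)\<rfloor>"
      using card_powers_upto_add_le[of l "n - 1 - l"] n by (simp add: of_nat_diff)
    then show "real (card (powers_upto l) + card (powers_upto (n - 1 - l)))
        \<le> real_of_int \<lfloor>2 * log 2 (real n - 1)\<rfloor>"
      by linarith
  qed (simp add: e_def)
  also have "\<dots> = real_of_int \<lfloor>2 * log 2 (real n - 1)\<rfloor> * dist1_eq S T"
    by (simp add: dist1_eq_def len e_def sum_distrib_left)
  finally show ?thesis .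
qed

text \<open>Both minima range over the same windows, so the window optimal for \<open>d'\<close> is
  a competitor for \<open>d\<close>. Only series of the shorter length are compared, hence
  \<open>K\<close> may depend on that length.\<close>

lemma sliding_min_le_mult:
  assumes "\<And>U V. length U = min (length S) (length T) \<Longrightarrow> length V = min (length S) (length T)
      \<Longrightarrow> d U V \<le> K * d' U V"
  shows "sliding_min d S T \<le> K * sliding_min d' S T"
proof -
  have Min_le_mult: "Min (f ` {0..N}) \<le> K * Min (g ` {0..N})"
    if "\<And>b. b \<le> N \<Longrightarrow> f b \<le> K * g b" for f g :: "nat \<Rightarrow> real" and N
  proof -
    have "Min (g ` {0..N}) \<in> g ` {0..N}" by (intro Min_in) auto
    then obtain b where b: "b \<le> N" "Min (g ` {0..N}) = g b"
      by (meson atLeastAtMost_iff imageE)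
    have "Min (f ` {0..N}) \<le> f b" using b by (intro Min_le) auto
    then show ?thesis using that[OF b(1)] b(2) by simp
  qed
  show ?thesis
    unfolding sliding_min_def
    by (auto intro!: Min_le_mult assms simp: subseries_def)
qed

lemma length_transform [simp]: "length (transform M v T) = length T"
  by (simp add: transform_def)

lemma subseries_transform: "subseries (transform M v T) b l = transform M v (subseries T b l)"
  by (simp add: subseries_def transform_def take_map drop_map)

text \<open>The shift \<open>v\<close> cancels in differences, and \<open>M\<close> preserves
  norms.\<close>

lemma reduced_structure_transform:
  fixes T :: "('k::finite) time_series"
  assumes "orthogonal_matrix M"
  shows "reduced_structure (transform M v T) = reduced_structure T"
proof -
  have isometry: "norm (M *v x - M *v y) = norm (x - y)" for x y
  proof -
    have "orthogonal_transformation ((*v) M)"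
      using assms by (simp add: orthogonal_transformation_matrix)
    then show ?thesis
      by (metis matrix_vector_mult_diff_distrib orthogonal_transformation_norm)
  qed
  show ?thesis
    unfolding reduced_structure_def length_transform
    by (intro restrict_ext) (auto simp: reduced_index_def transform_def isometry)
qed

lemma delta_dist1_transform:
  fixes S T :: "('k::finite) time_series"
  assumes "orthogonal_matrix M"
  shows "delta_dist1 S (transform M v T) = delta_dist1 S T"
  by (simp add: delta_dist1_def sliding_min_def delta_dist1_eq_def subseries_transform
      reduced_structure_transform[OF assms])

theorem theorem7:
  fixes S T :: "('k::finite) time_series"
  assumes "min (length S) (length T) \<ge> 3"
  shows "delta_dist1 S T
    \<le> real_of_int \<lfloor>2 * log 2 (real (min (length S) (length T)) - 1)\<rfloor> * congruence_dist1 S T"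
proof -
  define n where "n = min (length S) (length T)"
  define K where "K = real_of_int \<lfloor>2 * log 2 (real n - 1)\<rfloor>"
  have n: "n \<ge> 3" using assms by (simp add: n_def)
  \<comment> \<open>Positivity of \<open>K\<close> allows dividing by it, which turns
    \<open>bound\<close> into a lower bound for the infimum.\<close>
  have "1 \<le> log 2 (real n - 1)" using n by (subst le_log_iff) auto
  then have "1 \<le> \<lfloor>2 * log 2 (real n - 1)\<rfloor>" by (simp add: le_floor_iff)
  then have K: "K > 0" unfolding K_def by linarith
  have bound: "delta_dist1 S T \<le> K * dist1 S (transform M v T)" if M: "orthogonal_matrix M" for M v
  proof -
    have "delta_dist1 S (transform M v T) \<le> K * dist1 S (transform M v T)"
      unfolding delta_dist1_def dist1_def
      by (rule sliding_min_le_mult)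
        (simp add: K_def delta_dist1_eq_le_dist1_eq n flip: n_def)
    then show ?thesis by (simp add: delta_dist1_transform[OF M])
  qed
  \<comment> \<open>The identity shows that the infimum is over a nonempty set, as
    \<open>cINF_greatest\<close> requires.\<close>
  have "orthogonal_matrix (mat 1 :: real ^ 'k ^ 'k)" by (rule orthogonal_matrix_id)
  then have "delta_dist1 S T / K \<le> congruence_dist1 S T"
    unfolding congruence_dist1_def
    by (intro cINF_greatest) (use bound K in \<open>auto simp: pos_divide_le_eq mult.commute\<close>)
  then show ?thesis
    using K by (simp add: pos_divide_le_eq mult.commute flip: n_def K_def)
qed

end
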